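(* Let $L$ be a complete algebraic lattice. Then $a.c.o.(L)$ is a sublattice of $c.o.(L)$; that is, for all $\phi_1,\phi_2\in a.c.o.(L)$, the meet $\phi_1\wedge\phi_2$ and the join $\phi_1\vee\phi_2$ taken in $c.o.(L)$ both belong to $a.c.o.(L)$.
   Context: An element $c$ of a complete lattice $L$ is compact if $c\le\bigvee_{i\in I}x_i$ implies $c\le\bigvee_{i\in F}x_i$ for some finite $F\subseteq I$. $C(L)$ denotes the set of compact elements, and $k\le_c x$ means $k\in C(L)$ and $k\le x$. $L$ is algebraic if every element is a join of compact elements. A closure operator on $L$ is a map $\phi:L\to L$ such that $a\le\phi(a)$, $\phi(\phi(a))=\phi(a)$, and $a\le b$ implies $\phi(a)\le\phi(b)$, for all $a,b\in L$; $c.o.(L)$ is the set of all closure operators on $L$, ordered by $\phi_1\le\phi_2$ iff $\phi_1(x)\le\phi_2(x)$ for all $x\in L$. It is a known fact that $c.o.(L)$ is a complete lattice with $(\bigwedge_{i\in I}\phi_i)(x)=\bigwedge_{i\in I}\phi_i(x)$ and $(\bigvee_{i\in I}\phi_i)(x)=\bigwedge\{c\in L: c\ge x,\ \phi_i(c)=c\ \forall i\in I\}$. A map $\phi:L\to L$ is finitary if $\phi(x)=\bigvee_{k\le_c x}\phi(k)$ for all $x\in L$. $a.c.o.(L)$ (the algebraic closure operators) is the set of finitary $\phi\in c.o.(L)$. *)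

theory Defs
  imports Main
begin

context complete_lattice
begin

text \<open>A family in \<open>L\<close> enters only through its range, so compactness quantifies over
  subsets of \<open>L\<close> rather than over indexed families.\<close>

definition compact_elements :: "'a set" where
  "compact_elements =
    {c. \<forall>X. c \<le> Sup X \<longrightarrow> (\<exists>F. finite F \<and> F \<subseteq> X \<and> c \<le> Sup F)}"

definition compact_le :: "'a \<Rightarrow> 'a \<Rightarrow> bool"  (infix \<open>\<le>\<^sub>c\<close> 50) where
  "k \<le>\<^sub>c x \<longleftrightarrow> k \<in> compact_elements \<and> k \<le> x"

definition closure_operator :: "('a \<Rightarrow> 'a) \<Rightarrow> bool" where
  "closure_operator \<phi> \<longleftrightarrow>
    (\<forall>a. a \<le> \<phi> a) \<and> (\<forall>a. \<phi> (\<phi> a) = \<phi> a) \<and> (\<forall>a b. a \<le> b \<longrightarrow> \<phi> a \<le> \<phi> b)"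

definition finitary :: "('a \<Rightarrow> 'a) \<Rightarrow> bool" where
  "finitary \<phi> \<longleftrightarrow> (\<forall>x. \<phi> x = Sup {\<phi> k | k. k \<le>\<^sub>c x})"

end

class algebraic_lattice = complete_lattice +
  assumes join_of_compact: "\<exists>K. K \<subseteq> compact_elements \<and> x = Sup K"

text \<open>The lattice \<open>c.o.(L)\<close> is the type \<open>'a co\<close>. It is ordered pointwise, and its instance of
  \<^class>\<open>complete_lattice\<close> proves that the meets and joins given below are the meets and joins
  for this order.\<close>

typedef (overloaded) ('a::complete_lattice) co = "{\<phi> :: 'a \<Rightarrow> 'a. closure_operator \<phi>}"
  morphisms co_apply Abs_co
proof
  show "id \<in> {\<phi> :: 'a \<Rightarrow> 'a. closure_operator \<phi>}"
    by (simp add: closure_operator_def)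
qed

setup_lifting type_definition_co

lemma closure_operator_Inf:
  fixes A :: "('a::complete_lattice \<Rightarrow> 'a) set"
  assumes "\<And>\<phi>. \<phi> \<in> A \<Longrightarrow> closure_operator \<phi>"
  shows "closure_operator (\<lambda>x. INF \<phi>\<in>A. \<phi> x)"
proof -
  have ext: "a \<le> \<phi> a" and idem: "\<phi> (\<phi> a) = \<phi> a" and mono: "a \<le> b \<Longrightarrow> \<phi> a \<le> \<phi> b"
    if "\<phi> \<in> A" for \<phi> a b
    using assms[OF that] by (auto simp: closure_operator_def)
  have le: "a \<le> (INF \<phi>\<in>A. \<phi> a)" for a
    by (auto intro: INF_greatest ext)
  have mon: "(INF \<phi>\<in>A. \<phi> a) \<le> (INF \<phi>\<in>A. \<phi> b)" if "a \<le> b" for a b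
    using that by (auto intro!: INF_mono mono)
  have "(INF \<psi>\<in>A. \<psi> (INF \<phi>\<in>A. \<phi> a)) \<le> (INF \<phi>\<in>A. \<phi> a)" for a
  proof (rule INF_greatest)
    fix \<phi> assume \<phi>: "\<phi> \<in> A"
    have "(INF \<psi>\<in>A. \<psi> (INF \<phi>\<in>A. \<phi> a)) \<le> \<phi> (INF \<phi>\<in>A. \<phi> a)"
      using \<phi> by (rule INF_lower)
    also have "\<dots> \<le> \<phi> (\<phi> a)"
      using \<phi> INF_lower[OF \<phi>] by (rule mono)
    finally show "(INF \<psi>\<in>A. \<psi> (INF \<phi>\<in>A. \<phi> a)) \<le> \<phi> a"
      using idem[OF \<phi>] by simp
  qed
  then show ?thesis
    unfolding closure_operator_def using le mon by (blast intro: order.antisym)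
qed

lemma closure_operator_Inf_closed:
  fixes P :: "'a::complete_lattice \<Rightarrow> bool"
  assumes "\<And>C. (\<And>c. c \<in> C \<Longrightarrow> P c) \<Longrightarrow> P (Inf C)"
  shows "closure_operator (\<lambda>x. Inf {c. x \<le> c \<and> P c})"
proof -
  have le: "a \<le> Inf {c. a \<le> c \<and> P c}" for a
    by (auto intro: Inf_greatest)
  have mon: "Inf {c. a \<le> c \<and> P c} \<le> Inf {c. b \<le> c \<and> P c}" if "a \<le> b" for a b
    using that by (intro Inf_superset_mono) auto
  have "Inf {c. Inf {c. a \<le> c \<and> P c} \<le> c \<and> P c} \<le> Inf {c. a \<le> c \<and> P c}" for a
    by (rule Inf_lower) (auto intro: assms)
  then show ?thesis
    unfolding closure_operator_def using le mon by (blast intro: order.antisym)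
qed

lemma closed_upper:
  fixes \<phi> :: "'a::complete_lattice \<Rightarrow> 'a"
  assumes "closure_operator \<phi>" "x \<le> c" "\<phi> c = c"
  shows "\<phi> x \<le> c"
proof -
  have "\<phi> x \<le> \<phi> c"
    using assms(1,2) by (simp add: closure_operator_def)
  then show ?thesis
    using assms(3) by simp
qed

lemma closed_Inf:
  fixes \<phi> :: "'a::complete_lattice \<Rightarrow> 'a"
  assumes "closure_operator \<phi>" "\<And>c. c \<in> C \<Longrightarrow> \<phi> c = c"
  shows "\<phi> (Inf C) = Inf C"
proof (rule order.antisym)
  have "\<phi> (Inf C) \<le> c" if "c \<in> C" for c
    using assms(1) Inf_lower[OF that] assms(2)[OF that] by (rule closed_upper)
  then show "\<phi> (Inf C) \<le> Inf C"
    by (rule Inf_greatest)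
  show "Inf C \<le> \<phi> (Inf C)"
    using assms(1) by (simp add: closure_operator_def)
qed

lemma closure_operator_le:
  fixes \<phi> \<psi> :: "'a::complete_lattice \<Rightarrow> 'a"
  assumes "closure_operator \<phi>" "closure_operator \<psi>" "\<forall>x. \<phi> x \<le> \<psi> x"
  shows "\<phi> (\<psi> x) = \<psi> x"
proof (rule order.antisym)
  have "\<phi> (\<psi> x) \<le> \<psi> (\<psi> x)"
    using assms(3) by simp
  then show "\<phi> (\<psi> x) \<le> \<psi> x"
    using assms(2) by (simp add: closure_operator_def)
  show "\<psi> x \<le> \<phi> (\<psi> x)"
    using assms(1) by (simp add: closure_operator_def)
qed

lemma closure_operator_extensive:
  fixes \<phi> :: "'a::complete_lattice \<Rightarrow> 'a"
  shows "closure_operator \<phi> \<Longrightarrow> x \<le> \<phi> x"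
  by (simp add: closure_operator_def)

instantiation co :: (complete_lattice) complete_lattice
begin

lift_definition less_eq_co :: "'a co \<Rightarrow> 'a co \<Rightarrow> bool" is "\<lambda>\<phi> \<psi>. \<forall>x. \<phi> x \<le> \<psi> x" .

definition less_co :: "'a co \<Rightarrow> 'a co \<Rightarrow> bool" where
  "less_co \<phi> \<psi> \<longleftrightarrow> \<phi> \<le> \<psi> \<and> \<not> \<psi> \<le> \<phi>"

lift_definition Inf_co :: "'a co set \<Rightarrow> 'a co" is "\<lambda>A x. INF \<phi>\<in>A. \<phi> x"
  by (rule closure_operator_Inf) auto

lift_definition Sup_co :: "'a co set \<Rightarrow> 'a co"
  is "\<lambda>A x. Inf {c. x \<le> c \<and> (\<forall>\<phi>\<in>A. \<phi> c = c)}"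
  by (rule closure_operator_Inf_closed) (blast intro: closed_Inf)

lift_definition inf_co :: "'a co \<Rightarrow> 'a co \<Rightarrow> 'a co" is "\<lambda>\<phi> \<psi> x. inf (\<phi> x) (\<psi> x)"
proof -
  fix \<phi> \<psi> :: "'a \<Rightarrow> 'a"
  assume "closure_operator \<phi>" "closure_operator \<psi>"
  then show "closure_operator (\<lambda>x. inf (\<phi> x) (\<psi> x))"
    using closure_operator_Inf[of "{\<phi>, \<psi>}"] by auto
qed

lift_definition sup_co :: "'a co \<Rightarrow> 'a co \<Rightarrow> 'a co"
  is "\<lambda>\<phi> \<psi> x. Inf {c. x \<le> c \<and> \<phi> c = c \<and> \<psi> c = c}"
  by (rule closure_operator_Inf_closed) (blast intro: closed_Inf)

definition bot_co :: "'a co" where "bot_co = Sup {}"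

definition top_co :: "'a co" where "top_co = Inf {}"

instance
proof
  fix \<phi> \<psi> \<chi> :: "'a co" and A :: "'a co set"
  show "(\<phi> < \<psi>) = (\<phi> \<le> \<psi> \<and> \<not> \<psi> \<le> \<phi>)" by (rule less_co_def)
  show "\<phi> \<le> \<phi>" by transfer simp
  show "\<phi> \<le> \<psi> \<Longrightarrow> \<psi> \<le> \<chi> \<Longrightarrow> \<phi> \<le> \<chi>"
    unfolding less_eq_co.rep_eq by (blast intro: order_trans)
  show "\<phi> \<le> \<psi> \<Longrightarrow> \<psi> \<le> \<phi> \<Longrightarrow> \<phi> = \<psi>"
    unfolding less_eq_co.rep_eq co_apply_inject[symmetric] fun_eq_iff
    by (blast intro: order.antisym)
  show "inf \<phi> \<psi> \<le> \<phi>" "inf \<phi> \<psi> \<le> \<psi>" by (transfer, simp)+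
  show "\<phi> \<le> \<psi> \<Longrightarrow> \<phi> \<le> \<chi> \<Longrightarrow> \<phi> \<le> inf \<psi> \<chi>" by transfer simp
  have closure: "closure_operator (co_apply \<phi>)" for \<phi> :: "'a co"
    using co_apply by blast
  note closed_upper = closed_upper[OF closure]
    and closure_le = closure_operator_le[OF closure closure]
    and extensive = closure_operator_extensive[OF closure]
  show "\<phi> \<le> sup \<phi> \<psi>" "\<psi> \<le> sup \<phi> \<psi>"
    unfolding less_eq_co.rep_eq sup_co.rep_eq by (blast intro: Inf_greatest closed_upper)+
  show "\<psi> \<le> \<phi> \<Longrightarrow> \<chi> \<le> \<phi> \<Longrightarrow> sup \<psi> \<chi> \<le> \<phi>"
    unfolding less_eq_co.rep_eq sup_co.rep_eq by (simp add: Inf_lower closure_le extensive)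
  show "\<phi> \<in> A \<Longrightarrow> Inf A \<le> \<phi>"
    by transfer (blast intro: INF_lower)
  show "(\<And>\<psi>. \<psi> \<in> A \<Longrightarrow> \<phi> \<le> \<psi>) \<Longrightarrow> \<phi> \<le> Inf A"
    unfolding less_eq_co.rep_eq Inf_co.rep_eq by (auto intro!: INF_greatest)
  show "\<phi> \<in> A \<Longrightarrow> \<phi> \<le> Sup A"
    unfolding less_eq_co.rep_eq Sup_co.rep_eq by (blast intro: Inf_greatest closed_upper)
  show "(\<And>\<psi>. \<psi> \<in> A \<Longrightarrow> \<psi> \<le> \<phi>) \<Longrightarrow> Sup A \<le> \<phi>"
    unfolding less_eq_co.rep_eq Sup_co.rep_eq by (simp add: Inf_lower closure_le extensive)
  show "Inf {} = (top :: 'a co)" by (simp add: top_co_def)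
  show "Sup {} = (bot :: 'a co)" by (simp add: bot_co_def)
qed

end

definition aco :: "('a::complete_lattice) co set" where
  "aco = {\<phi>. finitary (co_apply \<phi>)}"

end

(* A monotone map on an algebraic lattice is finitary iff every compact c below \<phi> x already lies below
   \<phi> k for some compact k below x; this criterion passes to binary meets because compact elements are
   closed under binary joins. For the join \<sigma> of a set of finitary closure operators \<phi>, let
   s = Sup {\<sigma> k | k compact, k \<le> x}. If c is compact and c \<le> \<phi> s, then c \<le> \<phi> d for some compact
   d \<le> s, so d \<le> \<sigma> k for some compact k \<le> x, whence c \<le> \<phi> (\<sigma> k) = \<sigma> k \<le> s. Thus s is
   closed under every \<phi>, and \<sigma> x \<le> s. *)
theory Submission
  imports Defs
begin

text \<open>Each member of \<open>K\<close> has its own finite subcover, and the union of these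
  finitely many finite sets covers \<open>Sup K\<close>. For \<open>K = {}\<close> this makes
  \<open>bot\<close> compact.\<close>

lemma compact_elements_Sup:
  fixes K :: "'a::complete_lattice set"
  assumes "finite K" "K \<subseteq> compact_elements"
  shows "Sup K \<in> compact_elements"
  unfolding compact_elements_def
proof (intro CollectI allI impI)
  fix X :: "'a set"
  assume le: "Sup K \<le> Sup X"
  have "\<exists>F. finite F \<and> F \<subseteq> X \<and> k \<le> Sup F" if "k \<in> K" for k
  proof -
    have "k \<le> Sup X" using Sup_upper[OF that] le by (rule order_trans)
    then show ?thesis using that assms(2) by (auto simp: compact_elements_def)
  qed
  then obtain F where F: "\<And>k. k \<in> K \<Longrightarrow> finite (F k) \<and> F k \<subseteq> X \<and> k \<le> Sup (F k)"
    by metis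
  have "Sup K \<le> Sup (\<Union>k\<in>K. F k)"
  proof (rule Sup_least)
    fix k assume "k \<in> K"
    then have "k \<le> Sup (F k)" "F k \<subseteq> (\<Union>k\<in>K. F k)" using F by auto
    then show "k \<le> Sup (\<Union>k\<in>K. F k)" by (meson Sup_subset_mono order_trans)
  qed
  then show "\<exists>F. finite F \<and> F \<subseteq> X \<and> Sup K \<le> Sup F"
    using assms(1) F by (intro exI[of _ "\<Union>k\<in>K. F k"]) auto
qed

lemma compact_le_sup:
  fixes x :: "'a::complete_lattice"
  assumes "k \<le>\<^sub>c x" "l \<le>\<^sub>c x"
  shows "sup k l \<le>\<^sub>c x"
  using assms compact_elements_Sup[of "{k, l}"] by (simp add: compact_le_def)

text \<open>The values \<open>f k\<close> form a directed family: if finitely many of them cover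
  \<open>c\<close>, then by monotonicity \<open>f\<close> at the join of their arguments already
  lies above \<open>c\<close>. An empty subcover gives the witness \<open>bot\<close>.\<close>

lemma compact_le_Sup_image:
  fixes f :: "'a::complete_lattice \<Rightarrow> 'a"
  assumes "mono f" "c \<le>\<^sub>c Sup {f k | k. k \<le>\<^sub>c x}"
  shows "\<exists>k. k \<le>\<^sub>c x \<and> c \<le> f k"
proof -
  obtain F where F: "finite F" "F \<subseteq> f ` {k. k \<le>\<^sub>c x}" "c \<le> Sup F"
    using assms(2) unfolding compact_le_def compact_elements_def setcompr_eq_image by blast
  then obtain K where K: "finite K" "K \<subseteq> {k. k \<le>\<^sub>c x}" "F = f ` K"
    by (meson finite_subset_image)
  have "Sup F \<le> f (Sup K)"
    unfolding K(3) by (intro SUP_least monoD[OF assms(1)] Sup_upper)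
  moreover have "Sup K \<le>\<^sub>c x"
    using K(1,2) compact_elements_Sup[of K] by (auto simp: compact_le_def intro!: Sup_least)
  ultimately show ?thesis using F(3) order_trans by blast
qed

text \<open>Algebraicity enters here: it reduces an inequality to a test on compact
  elements.\<close>

lemma le_if_compact_le:
  fixes x :: "'a::algebraic_lattice"
  assumes "\<And>c. c \<le>\<^sub>c x \<Longrightarrow> c \<le> y"
  shows "x \<le> y"
proof -
  obtain K where "K \<subseteq> compact_elements" "x = Sup K" using join_of_compact by blast
  then show ?thesis using assms by (metis Sup_least Sup_upper compact_le_def subset_iff)
qed

lemma finitary_mono_iff:
  fixes f :: "'a::algebraic_lattice \<Rightarrow> 'a"
  assumes "mono f"
  shows "finitary f \<longleftrightarrow> (\<forall>c x. c \<le>\<^sub>c f x \<longrightarrow> (\<exists>k. k \<le>\<^sub>c x \<and> c \<le> f k))"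
    (is "_ \<longleftrightarrow> ?compact")
proof
  assume "finitary f"
  then show ?compact
    using compact_le_Sup_image[OF assms] unfolding finitary_def by metis
next
  assume compact: ?compact
  have "f x = Sup {f k | k. k \<le>\<^sub>c x}" for x
  proof (rule order.antisym)
    show "f x \<le> Sup {f k | k. k \<le>\<^sub>c x}"
    proof (rule le_if_compact_le)
      fix c assume "c \<le>\<^sub>c f x"
      then obtain k where "k \<le>\<^sub>c x" "c \<le> f k" using compact by blast
      then show "c \<le> Sup {f k | k. k \<le>\<^sub>c x}" by (intro Sup_upper2[of "f k"]) auto
    qed
    show "Sup {f k | k. k \<le>\<^sub>c x} \<le> f x"
      by (rule Sup_least) (auto simp: compact_le_def intro: monoD[OF assms])
  qed
  then show "finitary f" unfolding finitary_def by blast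
qed

lemma closure_operator_co_apply: "closure_operator (co_apply \<phi>)"
  using co_apply by blast

lemma mono_co_apply: "mono (co_apply \<phi>)"
  using closure_operator_co_apply[of \<phi>] unfolding closure_operator_def mono_def by blast

lemma aco_iff:
  fixes \<phi> :: "'a::algebraic_lattice co"
  shows "\<phi> \<in> aco \<longleftrightarrow>
    (\<forall>c x. c \<le>\<^sub>c co_apply \<phi> x \<longrightarrow> (\<exists>k. k \<le>\<^sub>c x \<and> c \<le> co_apply \<phi> k))"
  unfolding aco_def mem_Collect_eq by (rule finitary_mono_iff[OF mono_co_apply])

lemma inf_in_aco:
  fixes \<phi> \<psi> :: "'a::algebraic_lattice co"
  assumes "\<phi> \<in> aco" "\<psi> \<in> aco"
  shows "inf \<phi> \<psi> \<in> aco"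
  unfolding aco_iff inf_co.rep_eq
proof (intro allI impI)
  fix c x
  assume "c \<le>\<^sub>c inf (co_apply \<phi> x) (co_apply \<psi> x)"
  then have "c \<le>\<^sub>c co_apply \<phi> x" "c \<le>\<^sub>c co_apply \<psi> x" by (auto simp: compact_le_def)
  then obtain k l where k: "k \<le>\<^sub>c x" "c \<le> co_apply \<phi> k" and l: "l \<le>\<^sub>c x" "c \<le> co_apply \<psi> l"
    using assms unfolding aco_iff by blast
  \<comment> \<open>The witnesses for the two operators may differ; their join serves both.\<close>
  have "c \<le> co_apply \<phi> (sup k l)" "c \<le> co_apply \<psi> (sup k l)"
    using k(2) l(2) monoD[OF mono_co_apply] by (meson order_trans sup_ge1 sup_ge2)+
  then show "\<exists>k. k \<le>\<^sub>c x \<and> c \<le> inf (co_apply \<phi> k) (co_apply \<psi> k)"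
    using compact_le_sup[OF k(1) l(1)] by auto
qed

lemma Sup_in_aco:
  fixes A :: "'a::algebraic_lattice co set"
  assumes "A \<subseteq> aco"
  shows "Sup A \<in> aco"
proof -
  let ?\<sigma> = "co_apply (Sup A)"
  have "?\<sigma> x \<le> Sup {?\<sigma> k | k. k \<le>\<^sub>c x}" (is "_ \<le> ?s") for x
  proof -
    have le_s: "?\<sigma> k \<le> ?s" if "k \<le>\<^sub>c x" for k
      using that by (intro Sup_upper) auto
    \<comment> \<open>A compact \<open>c\<close> below \<open>x\<close> is itself an index of the
      join \<open>?s\<close>, and \<open>c\<close> lies below its own closure.\<close>
    have "x \<le> ?s"
    proof (rule le_if_compact_le)
      fix c assume "c \<le>\<^sub>c x"
      then have "?\<sigma> c \<le> ?s" by (rule le_s)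
      with closure_operator_extensive[OF closure_operator_co_apply] show "c \<le> ?s"
        by (rule order_trans)
    qed
    moreover have "co_apply \<phi> ?s = ?s" if \<phi>: "\<phi> \<in> A" for \<phi>
    proof (rule order.antisym)
      show "co_apply \<phi> ?s \<le> ?s"
      proof (rule le_if_compact_le)
        fix c assume "c \<le>\<^sub>c co_apply \<phi> ?s"
        then obtain d where d: "d \<le>\<^sub>c ?s" "c \<le> co_apply \<phi> d"
          using assms \<phi> aco_iff by blast
        obtain k where k: "k \<le>\<^sub>c x" "d \<le> ?\<sigma> k"
          using compact_le_Sup_image[OF mono_co_apply d(1)] by blast
        have "co_apply \<phi> d \<le> co_apply \<phi> (?\<sigma> k)" using k(2) by (rule monoD[OF mono_co_apply])
        \<comment> \<open>Since \<open>\<phi>\<close> lies below \<open>Sup A\<close>, every value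
          of \<open>Sup A\<close> is a fixed point of \<open>\<phi>\<close>.\<close>
        also have "\<dots> = ?\<sigma> k"
          using Sup_upper[OF \<phi>]
          by (intro closure_operator_le closure_operator_co_apply) (simp add: less_eq_co.rep_eq)
        also have "\<dots> \<le> ?s" using k(1) by (rule le_s)
        finally show "c \<le> ?s" using d(2) by (rule order_trans[rotated])
      qed
    qed (rule closure_operator_extensive[OF closure_operator_co_apply])
    \<comment> \<open>\<open>?s\<close> is one of the common fixed points above \<open>x\<close>
      whose infimum is the value of \<open>Sup A\<close> at \<open>x\<close>.\<close>
    ultimately have "Inf {c. x \<le> c \<and> (\<forall>\<phi>\<in>A. co_apply \<phi> c = c)} \<le> ?s"
      by (intro Inf_lower) blast
    then show ?thesis by (simp add: Sup_co.rep_eq)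
  qed
  moreover have "Sup {?\<sigma> k | k. k \<le>\<^sub>c x} \<le> ?\<sigma> x" for x
    by (rule Sup_least) (auto simp: compact_le_def intro: monoD[OF mono_co_apply])
  ultimately show ?thesis
    unfolding aco_def finitary_def by (blast intro: order.antisym)
qed

theorem proposition3p7:
  fixes \<phi>\<^sub>1 \<phi>\<^sub>2 :: "'a::algebraic_lattice co"
  assumes "\<phi>\<^sub>1 \<in> aco" and "\<phi>\<^sub>2 \<in> aco"
  shows "inf \<phi>\<^sub>1 \<phi>\<^sub>2 \<in> aco \<and> sup \<phi>\<^sub>1 \<phi>\<^sub>2 \<in> aco"
  \<comment> \<open>The binary join is the \<open>Sup\<close> of the pair.\<close>
  using inf_in_aco[OF assms] Sup_in_aco[of "{\<phi>\<^sub>1, \<phi>\<^sub>2}"] assms by simp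

end
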